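(* Let $(G,H,\alpha,\tau)$ and $(H,J,\alpha',\tau')$ be Lie crossed modules such that $\tau'(J)$ is closed in $H$ and $\tau\tau'(J)$ is closed in $G$, and let $\mathbf G$ be the categorical group associated with $(G,H,\alpha,\tau)$. Put $J_H=\{(\tau'(j),\tau\tau'(j')):j,j'\in J\}\subset H\rtimes_\alpha G$ and let $\overline{\mathbf G}$ have object set and morphism set the sets of cosets $$\mathrm{Obj}(\overline{\mathbf G})=G/\tau\tau'(J),\qquad \mathrm{Mor}(\overline{\mathbf G})=(H\rtimes_\alpha G)/J_H .$$ Then $\overline{\mathbf G}$ is a category under composition, source and target as inherited from $\mathbf G$ (that is, the source, target and composition maps induced from those of $\mathbf G$ on representatives are well defined and make $\overline{\mathbf G}$ a category). The quotient mappings $$\mathrm{Obj}(\mathbf G)\to\mathrm{Obj}(\overline{\mathbf G}):g\mapsto g\,\tau\tau'(J),\qquad \mathrm{Mor}(\mathbf G)\to\mathrm{Mor}(\overline{\mathbf G}):(h,g)\mapsto(h,g)J_H$$ specify a functor $q:\mathbf G\to\overline{\mathbf G}$.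
   Context: A crossed module $(G,H,\alpha,\tau)$ consists of groups $G,H$ and homomorphisms $\tau:H\to G$, $\alpha:G\to\mathrm{Aut}(H)$ with $\tau(\alpha_g(h))=g\tau(h)g^{-1}$ and $\alpha_{\tau(h)}(h')=hh'h^{-1}$. It is a Lie crossed module if $G,H$ are Lie groups and $\tau$ and $(h,g)\mapsto\alpha_g(h)$ are smooth. The associated categorical group $\mathbf G$ has $\mathrm{Obj}(\mathbf G)=G$, $\mathrm{Mor}(\mathbf G)=H\rtimes_\alpha G$ with product $(h_2,g_2)(h_1,g_1)=(h_2\alpha_{g_2}(h_1),g_2g_1)$, source $s(h,g)=g$, target $t(h,g)=\tau(h)g$, and composition $(h_2,g_2)\circ(h_1,g_1)=(h_2h_1,g_1)$ when $g_2=\tau(h_1)g_1$. $J_H$ is a subgroup of $H\rtimes_\alpha G$ and $\tau\tau'(J)$ is a subgroup of $G$, neither necessarily normal; quotients are sets of left cosets. The induced composition of two cosets is defined when the target of the first coset equals the source of the second in $G/\tau\tau'(J)$; it is then the coset of $f_2\circ f_1$ for any representatives $f_1,f_2$ that are composable in $\mathbf G$. *)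

theory Defs
  imports "HOL-Analysis.Analysis" "HOL-Algebra.Algebra"
begin

section \<open>Smooth manifolds\<close>

text \<open>
  The model space \<open>\<real>\<^sup>n\<close> is \<^term>\<open>Euclidean_space n\<close>, whose points are the functions
  \<open>nat \<Rightarrow> real\<close> that vanish from \<open>n\<close> on. This allows dimension \<open>0\<close> (discrete groups), which an
  \<open>euclidean_space\<close> type as model would exclude, and products of manifolds of different
  dimensions.
\<close>

primrec C_k_on :: "nat \<Rightarrow> nat \<Rightarrow> (nat \<Rightarrow> real) set \<Rightarrow> ((nat \<Rightarrow> real) \<Rightarrow> real) \<Rightarrow> bool" where
  "C_k_on 0 n U f \<longleftrightarrow>
     continuous_map (subtopology (Euclidean_space n) U) euclideanreal f"
| "C_k_on (Suc k) n U f \<longleftrightarrow>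
     continuous_map (subtopology (Euclidean_space n) U) euclideanreal f \<and>
     (\<forall>i<n. \<exists>f'. (\<forall>x\<in>U. ((\<lambda>t. f (x(i := t))) has_real_derivative f' x) (at (x i))) \<and>
        C_k_on k n U f')"

definition smooth_on :: "nat \<Rightarrow> (nat \<Rightarrow> real) set \<Rightarrow> nat \<Rightarrow> ((nat \<Rightarrow> real) \<Rightarrow> nat \<Rightarrow> real) \<Rightarrow> bool"
  where "smooth_on n U m F \<longleftrightarrow> (\<forall>j<m. \<forall>k. C_k_on k n U (\<lambda>x. F x j))"

text \<open>A chart \<open>(U, \<phi>)\<close> uses the values of \<open>\<phi>\<close> on \<open>U\<close> only. The atlas need not be maximal.\<close>

record 'a mfd =
  mtop :: "'a topology"
  mdim :: nat
  charts :: "('a set \<times> ('a \<Rightarrow> nat \<Rightarrow> real)) set"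

definition smooth_manifold :: "'a mfd \<Rightarrow> bool" where
  "smooth_manifold M \<longleftrightarrow>
     Hausdorff_space (mtop M) \<and> second_countable (mtop M) \<and>
     (\<Union>(U, \<phi>)\<in>charts M. U) = topspace (mtop M) \<and>
     (\<forall>(U, \<phi>)\<in>charts M.
        openin (mtop M) U \<and> openin (Euclidean_space (mdim M)) (\<phi> ` U) \<and>
        homeomorphic_map (subtopology (mtop M) U)
          (subtopology (Euclidean_space (mdim M)) (\<phi> ` U)) \<phi>) \<and>
     (\<forall>(U, \<phi>)\<in>charts M. \<forall>(V, \<psi>)\<in>charts M.
        smooth_on (mdim M) (\<phi> ` (U \<inter> V)) (mdim M) (\<psi> \<circ> inv_into U \<phi>))"

definition smooth_map :: "'a mfd \<Rightarrow> 'b mfd \<Rightarrow> ('a \<Rightarrow> 'b) \<Rightarrow> bool" where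
  "smooth_map M N f \<longleftrightarrow>
     continuous_map (mtop M) (mtop N) f \<and>
     (\<forall>(U, \<phi>)\<in>charts M. \<forall>(V, \<psi>)\<in>charts N.
        smooth_on (mdim M) (\<phi> ` (U \<inter> f -` V)) (mdim N) (\<psi> \<circ> f \<circ> inv_into U \<phi>))"

definition prod_mfd :: "'a mfd \<Rightarrow> 'b mfd \<Rightarrow> ('a \<times> 'b) mfd" where
  "prod_mfd M N =
     \<lparr>mtop = prod_topology (mtop M) (mtop N),
      mdim = mdim M + mdim N,
      charts = (\<lambda>((U, \<phi>), (V, \<psi>)).
          (U \<times> V, \<lambda>(x, y) i. if i < mdim M then \<phi> x i else \<psi> y (i - mdim M)))
        ` (charts M \<times> charts N)\<rparr>"


section \<open>Lie groups and crossed modules\<close>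

record 'a lie_str = "'a monoid" +
  mfd :: "'a mfd"

definition lie_group :: "'a lie_str \<Rightarrow> bool" where
  "lie_group G \<longleftrightarrow>
     group G \<and> smooth_manifold (mfd G) \<and> topspace (mtop (mfd G)) = carrier G \<and>
     smooth_map (prod_mfd (mfd G) (mfd G)) (mfd G) (\<lambda>(x, y). x \<otimes>\<^bsub>G\<^esub> y) \<and>
     smooth_map (mfd G) (mfd G) (\<lambda>x. inv\<^bsub>G\<^esub> x)"

definition crossed_module ::
  "('g, 'x) monoid_scheme \<Rightarrow> ('h, 'y) monoid_scheme \<Rightarrow> ('g \<Rightarrow> 'h \<Rightarrow> 'h) \<Rightarrow> ('h \<Rightarrow> 'g) \<Rightarrow> bool"
  where
  "crossed_module G H \<alpha> \<tau> \<longleftrightarrow>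
     group G \<and> group H \<and> \<tau> \<in> hom H G \<and> \<alpha> \<in> hom G (AutoGroup H) \<and>
     (\<forall>g\<in>carrier G. \<forall>h\<in>carrier H. \<tau> (\<alpha> g h) = g \<otimes>\<^bsub>G\<^esub> \<tau> h \<otimes>\<^bsub>G\<^esub> inv\<^bsub>G\<^esub> g) \<and>
     (\<forall>h\<in>carrier H. \<forall>h'\<in>carrier H. \<alpha> (\<tau> h) h' = h \<otimes>\<^bsub>H\<^esub> h' \<otimes>\<^bsub>H\<^esub> inv\<^bsub>H\<^esub> h)"

definition lie_crossed_module ::
  "'g lie_str \<Rightarrow> 'h lie_str \<Rightarrow> ('g \<Rightarrow> 'h \<Rightarrow> 'h) \<Rightarrow> ('h \<Rightarrow> 'g) \<Rightarrow> bool" where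
  "lie_crossed_module G H \<alpha> \<tau> \<longleftrightarrow>
     crossed_module G H \<alpha> \<tau> \<and> lie_group G \<and> lie_group H \<and>
     smooth_map (mfd H) (mfd G) \<tau> \<and>
     smooth_map (prod_mfd (mfd H) (mfd G)) (mfd H) (\<lambda>(h, g). \<alpha> g h)"

definition semidirect ::
  "('h, 'y) monoid_scheme \<Rightarrow> ('g, 'x) monoid_scheme \<Rightarrow> ('g \<Rightarrow> 'h \<Rightarrow> 'h) \<Rightarrow> ('h \<times> 'g) monoid" where
  "semidirect H G \<alpha> =
     \<lparr>carrier = carrier H \<times> carrier G,
      mult = (\<lambda>(h2, g2) (h1, g1). (h2 \<otimes>\<^bsub>H\<^esub> \<alpha> g2 h1, g2 \<otimes>\<^bsub>G\<^esub> g1)),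
      one = (\<one>\<^bsub>H\<^esub>, \<one>\<^bsub>G\<^esub>)\<rparr>"


section \<open>Categories and functors\<close>

text \<open>
  \<open>Comp C f2 f1\<close> is \<open>f2 \<circ> f1\<close>; its value matters only if \<open>Src C f2 = Tgt C f1\<close>. Identities
  are not part of the data, since the unit laws determine them.
\<close>

record ('o, 'm) cat =
  Obj :: "'o set"
  Mor :: "'m set"
  Src :: "'m \<Rightarrow> 'o"
  Tgt :: "'m \<Rightarrow> 'o"
  Comp :: "'m \<Rightarrow> 'm \<Rightarrow> 'm"

definition is_identity :: "('o, 'm) cat \<Rightarrow> 'o \<Rightarrow> 'm \<Rightarrow> bool" where
  "is_identity C a e \<longleftrightarrow>
     e \<in> Mor C \<and> Src C e = a \<and> Tgt C e = a \<and>
     (\<forall>f\<in>Mor C. Src C f = a \<longrightarrow> Comp C f e = f) \<and>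
     (\<forall>f\<in>Mor C. Tgt C f = a \<longrightarrow> Comp C e f = f)"

definition category :: "('o, 'm) cat \<Rightarrow> bool" where
  "category C \<longleftrightarrow>
     Src C \<in> Mor C \<rightarrow> Obj C \<and> Tgt C \<in> Mor C \<rightarrow> Obj C \<and>
     (\<forall>f1\<in>Mor C. \<forall>f2\<in>Mor C. Src C f2 = Tgt C f1 \<longrightarrow>
        Comp C f2 f1 \<in> Mor C \<and> Src C (Comp C f2 f1) = Src C f1 \<and>
        Tgt C (Comp C f2 f1) = Tgt C f2) \<and>
     (\<forall>f1\<in>Mor C. \<forall>f2\<in>Mor C. \<forall>f3\<in>Mor C. Src C f2 = Tgt C f1 \<longrightarrow> Src C f3 = Tgt C f2 \<longrightarrow>
        Comp C f3 (Comp C f2 f1) = Comp C (Comp C f3 f2) f1) \<and>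
     (\<forall>a\<in>Obj C. \<exists>e. is_identity C a e)"

definition is_functor ::
  "('o, 'm) cat \<Rightarrow> ('p, 'n) cat \<Rightarrow> ('o \<Rightarrow> 'p) \<Rightarrow> ('m \<Rightarrow> 'n) \<Rightarrow> bool" where
  "is_functor C D F\<^sub>o F\<^sub>m \<longleftrightarrow>
     category C \<and> category D \<and> F\<^sub>o \<in> Obj C \<rightarrow> Obj D \<and> F\<^sub>m \<in> Mor C \<rightarrow> Mor D \<and>
     (\<forall>f\<in>Mor C. Src D (F\<^sub>m f) = F\<^sub>o (Src C f) \<and> Tgt D (F\<^sub>m f) = F\<^sub>o (Tgt C f)) \<and>
     (\<forall>f1\<in>Mor C. \<forall>f2\<in>Mor C. Src C f2 = Tgt C f1 \<longrightarrow>
        F\<^sub>m (Comp C f2 f1) = Comp D (F\<^sub>m f2) (F\<^sub>m f1)) \<and>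
     (\<forall>a\<in>Obj C. \<forall>e. is_identity C a e \<longrightarrow> is_identity D (F\<^sub>o a) (F\<^sub>m e))"


section \<open>The categorical group of a crossed module and its quotient\<close>

definition cat_group ::
  "('g, 'x) monoid_scheme \<Rightarrow> ('h, 'y) monoid_scheme \<Rightarrow> ('g \<Rightarrow> 'h \<Rightarrow> 'h) \<Rightarrow> ('h \<Rightarrow> 'g) \<Rightarrow>
    ('g, 'h \<times> 'g) cat" where
  "cat_group G H \<alpha> \<tau> =
     \<lparr>Obj = carrier G,
      Mor = carrier (semidirect H G \<alpha>),
      Src = (\<lambda>(h, g). g),
      Tgt = (\<lambda>(h, g). \<tau> h \<otimes>\<^bsub>G\<^esub> g),
      Comp = (\<lambda>(h2, g2) (h1, g1). (h2 \<otimes>\<^bsub>H\<^esub> h1, g1))\<rparr>"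

definition J_obj :: "('j, 'z) monoid_scheme \<Rightarrow> ('h \<Rightarrow> 'g) \<Rightarrow> ('j \<Rightarrow> 'h) \<Rightarrow> 'g set" where
  "J_obj J \<tau> \<tau>' = {\<tau> (\<tau>' j) | j. j \<in> carrier J}"

definition J_mor :: "('j, 'z) monoid_scheme \<Rightarrow> ('h \<Rightarrow> 'g) \<Rightarrow> ('j \<Rightarrow> 'h) \<Rightarrow> ('h \<times> 'g) set" where
  "J_mor J \<tau> \<tau>' = {(\<tau>' j, \<tau> (\<tau>' j')) | j j'. j \<in> carrier J \<and> j' \<in> carrier J}"

text \<open>
  For a category \<open>C\<close> whose objects and morphisms are elements of groups \<open>A\<close> and \<open>B\<close>, and for
  \<open>K \<subseteq> A\<close> and \<open>L \<subseteq> B\<close>, the following relations say that a coset is the source, target or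
  composite of given cosets as computed from some representatives. The induced maps are well
  defined iff these relations determine their last argument uniquely.
\<close>

definition induced_src ::
  "('o, 'm) cat \<Rightarrow> ('o, 'x) monoid_scheme \<Rightarrow> 'o set \<Rightarrow> 'm set \<Rightarrow> 'o set \<Rightarrow> bool" where
  "induced_src C A K c d \<longleftrightarrow> (\<exists>f\<in>c. d = Src C f <#\<^bsub>A\<^esub> K)"

definition induced_tgt ::
  "('o, 'm) cat \<Rightarrow> ('o, 'x) monoid_scheme \<Rightarrow> 'o set \<Rightarrow> 'm set \<Rightarrow> 'o set \<Rightarrow> bool" where
  "induced_tgt C A K c d \<longleftrightarrow> (\<exists>f\<in>c. d = Tgt C f <#\<^bsub>A\<^esub> K)"

definition induced_comp ::
  "('o, 'm) cat \<Rightarrow> ('m, 'y) monoid_scheme \<Rightarrow> 'm set \<Rightarrow> 'm set \<Rightarrow> 'm set \<Rightarrow> 'm set \<Rightarrow> bool"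
  where
  "induced_comp C B L c2 c1 c \<longleftrightarrow>
     (\<exists>f2\<in>c2. \<exists>f1\<in>c1. Src C f2 = Tgt C f1 \<and> c = Comp C f2 f1 <#\<^bsub>B\<^esub> L)"

definition quotient_cat ::
  "('o, 'm) cat \<Rightarrow> ('o, 'x) monoid_scheme \<Rightarrow> 'o set \<Rightarrow> ('m, 'y) monoid_scheme \<Rightarrow> 'm set \<Rightarrow>
    ('o set, 'm set) cat" where
  "quotient_cat C A K B L =
     \<lparr>Obj = lcosets\<^bsub>A\<^esub> K,
      Mor = lcosets\<^bsub>B\<^esub> L,
      Src = (\<lambda>c. THE d. induced_src C A K c d),
      Tgt = (\<lambda>c. THE d. induced_tgt C A K c d),
      Comp = (\<lambda>c2 c1. THE c. induced_comp C B L c2 c1 c)\<rparr>"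

end

theory Submission
  imports Defs
begin

text \<open>
  Composition of cosets is defined as soon as the source of a morphism can be moved to any point of
  its coset by changing the representative; then all category laws follow from those upstairs.
  Here \<open>N = \<tau>'(J)\<close> is normal in \<open>H\<close>, the subgroups are \<open>\<tau>(N)\<close> and \<open>N \<times> \<tau>(N)\<close>, and the coset of
  \<open>(h, g)\<close> is \<open>h \<alpha>\<^sub>g(N) \<times> g \<tau>(N)\<close>. Composition respects these cosets because
  \<open>\<alpha>\<^bsub>\<tau>(h)g\<^esub>(N) = h \<alpha>\<^sub>g(N) h\<inverse>\<close>, so the factor in \<open>\<alpha>\<^bsub>\<tau>(h)g\<^esub>(N)\<close> can be moved past \<open>h\<close>.
\<close>

section \<open>Quotient of a category by cosets\<close>

text \<open>\<open>Comp_cong\<close> compares only pairs that are composable upstairs, exactly as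
  the induced composition does. \<open>Src_lift\<close> supplies composable representatives and the
  right unit law, \<open>Tgt_lift\<close> the left unit law.\<close>

locale coset_category =
  A: group A + B: group B + K: subgroup K A + L: subgroup L B
  for C :: "('o, 'm) cat" and A :: "('o, 'x) monoid_scheme" and K :: "'o set"
    and B :: "('m, 'y) monoid_scheme" and L :: "'m set" +
  assumes category: "category C"
    and Obj_eq: "Obj C = carrier A"
    and Mor_eq: "Mor C = carrier B"
    and Src_cong: "\<lbrakk>f \<in> carrier B; f' \<in> f <#\<^bsub>B\<^esub> L\<rbrakk> \<Longrightarrow> Src C f' <#\<^bsub>A\<^esub> K = Src C f <#\<^bsub>A\<^esub> K"
    and Tgt_cong: "\<lbrakk>f \<in> carrier B; f' \<in> f <#\<^bsub>B\<^esub> L\<rbrakk> \<Longrightarrow> Tgt C f' <#\<^bsub>A\<^esub> K = Tgt C f <#\<^bsub>A\<^esub> K"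
    and Comp_cong: "\<lbrakk>f1 \<in> carrier B; f2 \<in> carrier B; Src C f2 = Tgt C f1;
        f1' \<in> f1 <#\<^bsub>B\<^esub> L; f2' \<in> f2 <#\<^bsub>B\<^esub> L; Src C f2' = Tgt C f1'\<rbrakk>
        \<Longrightarrow> Comp C f2' f1' \<in> Comp C f2 f1 <#\<^bsub>B\<^esub> L"
    and Src_lift: "\<lbrakk>f \<in> carrier B; b \<in> Src C f <#\<^bsub>A\<^esub> K\<rbrakk> \<Longrightarrow> \<exists>f'\<in>f <#\<^bsub>B\<^esub> L. Src C f' = b"
    and Tgt_lift: "\<lbrakk>f \<in> carrier B; b \<in> Tgt C f <#\<^bsub>A\<^esub> K\<rbrakk> \<Longrightarrow> \<exists>f'\<in>f <#\<^bsub>B\<^esub> L. Tgt C f' = b"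
begin

abbreviation obj_class :: "'o \<Rightarrow> 'o set" where "obj_class a \<equiv> a <#\<^bsub>A\<^esub> K"
abbreviation mor_class :: "'m \<Rightarrow> 'm set" where "mor_class f \<equiv> f <#\<^bsub>B\<^esub> L"
abbreviation Q :: "('o set, 'm set) cat" where "Q \<equiv> quotient_cat C A K B L"

lemma obj_class_self: "a \<in> carrier A \<Longrightarrow> a \<in> obj_class a"
  by (rule A.lcos_self[OF _ K.subgroup_axioms])

lemma mor_class_self: "f \<in> carrier B \<Longrightarrow> f \<in> mor_class f"
  by (rule B.lcos_self[OF _ L.subgroup_axioms])

lemma mor_class_carrier: "\<lbrakk>f \<in> carrier B; f' \<in> mor_class f\<rbrakk> \<Longrightarrow> f' \<in> carrier B"
  by (rule L.elemlcos_carrier[OF B.group_axioms])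

lemma mor_class_eq: "\<lbrakk>f \<in> carrier B; f' \<in> mor_class f\<rbrakk> \<Longrightarrow> mor_class f' = mor_class f"
  using B.l_repr_independence[OF _ _ L.subgroup_axioms] by auto

lemma Mor_Q: "Mor Q = mor_class ` carrier B" and Obj_Q: "Obj Q = obj_class ` carrier A"
  by (auto simp: quotient_cat_def LCOSETS_def)

lemma Src_closed: "f \<in> carrier B \<Longrightarrow> Src C f \<in> carrier A"
  and Tgt_closed: "f \<in> carrier B \<Longrightarrow> Tgt C f \<in> carrier A"
  using category Obj_eq Mor_eq by (auto simp: category_def)

lemma Comp_C:
  assumes "f1 \<in> carrier B" "f2 \<in> carrier B" "Src C f2 = Tgt C f1"
  shows "Comp C f2 f1 \<in> carrier B" "Src C (Comp C f2 f1) = Src C f1"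
    "Tgt C (Comp C f2 f1) = Tgt C f2"
  using category assms Mor_eq by (auto simp: category_def)

section \<open>Induced source, target and composition\<close>

lemma induced_src_iff:
  "f \<in> carrier B \<Longrightarrow> induced_src C A K (mor_class f) d \<longleftrightarrow> d = obj_class (Src C f)"
  using Src_cong mor_class_self unfolding induced_src_def by blast

lemma induced_tgt_iff:
  "f \<in> carrier B \<Longrightarrow> induced_tgt C A K (mor_class f) d \<longleftrightarrow> d = obj_class (Tgt C f)"
  using Tgt_cong mor_class_self unfolding induced_tgt_def by blast

text \<open>By \<open>Comp_cong\<close> all composable representatives compose into the coset of
  \<open>Comp C f2 f1\<close>, hence yield the same coset; \<open>f1\<close> and \<open>f2\<close>
  themselves give existence. This evaluates the \<open>THE\<close> in
  \<open>quotient_cat\<close>.\<close>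

lemma induced_comp_iff:
  assumes "f1 \<in> carrier B" "f2 \<in> carrier B" "Src C f2 = Tgt C f1"
  shows "induced_comp C B L (mor_class f2) (mor_class f1) c \<longleftrightarrow> c = mor_class (Comp C f2 f1)"
proof
  assume "induced_comp C B L (mor_class f2) (mor_class f1) c"
  then obtain f2' f1' where "f2' \<in> mor_class f2" "f1' \<in> mor_class f1" "Src C f2' = Tgt C f1'"
    "c = mor_class (Comp C f2' f1')"
    unfolding induced_comp_def by blast
  then show "c = mor_class (Comp C f2 f1)"
    using Comp_cong[OF assms] mor_class_eq Comp_C(1)[OF assms] by blast
next
  assume "c = mor_class (Comp C f2 f1)"
  then show "induced_comp C B L (mor_class f2) (mor_class f1) c"
    unfolding induced_comp_def using assms mor_class_self by blast
qed

lemma Src_Q: "f \<in> carrier B \<Longrightarrow> Src Q (mor_class f) = obj_class (Src C f)"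
  and Tgt_Q: "f \<in> carrier B \<Longrightarrow> Tgt Q (mor_class f) = obj_class (Tgt C f)"
  by (auto simp: quotient_cat_def induced_src_iff induced_tgt_iff intro!: the_equality)

lemma Comp_Q:
  assumes "f1 \<in> carrier B" "f2 \<in> carrier B" "Src C f2 = Tgt C f1"
  shows "Comp Q (mor_class f2) (mor_class f1) = mor_class (Comp C f2 f1)"
  by (auto simp: quotient_cat_def induced_comp_iff[OF assms] intro!: the_equality)

section \<open>Choice of representatives and the category laws\<close>

text \<open>Equality of object cosets puts \<open>b\<close> in the coset of the source of any
  representative of \<open>c\<close>, and \<open>Src_lift\<close> replaces that representative by
  one starting exactly at \<open>b\<close>.\<close>

lemma mor_class_Src:
  assumes "c \<in> Mor Q" "Src Q c = obj_class b" "b \<in> carrier A"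
  obtains f where "f \<in> carrier B" "c = mor_class f" "Src C f = b"
proof -
  obtain f where f: "f \<in> carrier B" "c = mor_class f"
    using assms(1) by (auto simp: Mor_Q)
  then have "b \<in> obj_class (Src C f)"
    using assms(2,3) Src_Q obj_class_self by auto
  then obtain f' where "f' \<in> mor_class f" "Src C f' = b"
    using Src_lift[OF f(1)] by blast
  then show thesis
    using that[of f'] f mor_class_carrier[OF f(1)] mor_class_eq[OF f(1)] by simp
qed

text \<open>The mirror image through \<open>Tgt_lift\<close>, for the left unit law, where the
  representative must end exactly at the given object.\<close>

lemma mor_class_Tgt:
  assumes "c \<in> Mor Q" "Tgt Q c = obj_class b" "b \<in> carrier A"
  obtains f where "f \<in> carrier B" "c = mor_class f" "Tgt C f = b"
proof -
  obtain f where f: "f \<in> carrier B" "c = mor_class f"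
    using assms(1) by (auto simp: Mor_Q)
  then have "b \<in> obj_class (Tgt C f)"
    using assms(2,3) Tgt_Q obj_class_self by auto
  then obtain f' where "f' \<in> mor_class f" "Tgt C f' = b"
    using Tgt_lift[OF f(1)] by blast
  then show thesis
    using that[of f'] f mor_class_carrier[OF f(1)] mor_class_eq[OF f(1)] by simp
qed

text \<open>The representative \<open>f1\<close> is arbitrary; only \<open>f2\<close> is adjusted,
  so as to start at the actual target of \<open>f1\<close>.\<close>

lemma composable_pair:
  assumes "c1 \<in> Mor Q" "c2 \<in> Mor Q" "Src Q c2 = Tgt Q c1"
  obtains f1 f2 where "f1 \<in> carrier B" "f2 \<in> carrier B" "c1 = mor_class f1" "c2 = mor_class f2"
    "Src C f2 = Tgt C f1"
proof -
  obtain f1 where f1: "f1 \<in> carrier B" "c1 = mor_class f1"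
    using assms(1) by (auto simp: Mor_Q)
  moreover obtain f2 where "f2 \<in> carrier B" "c2 = mor_class f2" "Src C f2 = Tgt C f1"
    using mor_class_Src[OF assms(2), of "Tgt C f1"] assms(3) f1 Tgt_Q Tgt_closed by auto
  ultimately show thesis by (intro that)
qed

text \<open>A morphism class starting or ending at the class of \<open>a\<close> has a
  representative starting or ending at \<open>a\<close> itself, so the unit laws of \<open>C\<close>
  apply. This serves both the existence of identities in \<open>Q\<close> and their preservation by
  the functor.\<close>

lemma is_identity_Q:
  assumes a: "a \<in> carrier A" and e: "is_identity C a e"
  shows "is_identity Q (obj_class a) (mor_class e)"
proof -
  have eB: "e \<in> carrier B" and eST: "Src C e = a" "Tgt C e = a"
    using e Mor_eq by (auto simp: is_identity_def)
  have "Comp Q c (mor_class e) = c" if c: "c \<in> Mor Q" "Src Q c = obj_class a" for c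
  proof -
    obtain f where f: "f \<in> carrier B" "c = mor_class f" "Src C f = a"
      by (rule mor_class_Src[OF c a])
    moreover from this have "Comp C f e = f"
      using e Mor_eq by (auto simp: is_identity_def)
    ultimately show ?thesis using Comp_Q[OF eB] eST by simp
  qed
  moreover have "Comp Q (mor_class e) c = c" if c: "c \<in> Mor Q" "Tgt Q c = obj_class a" for c
  proof -
    obtain f where f: "f \<in> carrier B" "c = mor_class f" "Tgt C f = a"
      by (rule mor_class_Tgt[OF c a])
    moreover from this have "Comp C e f = f"
      using e Mor_eq by (auto simp: is_identity_def)
    ultimately show ?thesis using Comp_Q[OF _ eB] eST by simp
  qed
  moreover have "mor_class e \<in> Mor Q" using eB by (simp add: Mor_Q)
  ultimately show ?thesis
    unfolding is_identity_def by (simp add: Src_Q[OF eB] Tgt_Q[OF eB] eST)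
qed

lemma category_Q: "category Q"
  unfolding category_def
proof (intro conjI ballI impI)
  show "Src Q \<in> Mor Q \<rightarrow> Obj Q" "Tgt Q \<in> Mor Q \<rightarrow> Obj Q"
    using Src_Q Tgt_Q Src_closed Tgt_closed by (auto simp: Mor_Q Obj_Q)
next
  fix c1 c2 assume c: "c1 \<in> Mor Q" "c2 \<in> Mor Q" "Src Q c2 = Tgt Q c1"
  obtain f1 f2 where f: "f1 \<in> carrier B" "f2 \<in> carrier B" "Src C f2 = Tgt C f1"
    and eq: "c1 = mor_class f1" "c2 = mor_class f2"
    using composable_pair[OF c] by metis
  show "Comp Q c2 c1 \<in> Mor Q"
    using Comp_C[OF f] by (simp add: eq Comp_Q[OF f] Mor_Q)
  show "Src Q (Comp Q c2 c1) = Src Q c1" "Tgt Q (Comp Q c2 c1) = Tgt Q c2"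
    using Comp_C[OF f] f by (simp_all add: eq Comp_Q[OF f] Src_Q Tgt_Q)
next
  fix c1 c2 c3
  assume c: "c1 \<in> Mor Q" "c2 \<in> Mor Q" "Src Q c2 = Tgt Q c1"
    and c3: "c3 \<in> Mor Q" "Src Q c3 = Tgt Q c2"
  obtain f1 f2 where f: "f1 \<in> carrier B" "f2 \<in> carrier B" "Src C f2 = Tgt C f1"
    and eq: "c1 = mor_class f1" "c2 = mor_class f2"
    using composable_pair[OF c] by metis
  \<comment> \<open>\<open>f3\<close> is chosen after \<open>f2\<close>, to start at its target.
    Thus \<open>f1\<close>, \<open>f2\<close>, \<open>f3\<close> form a composable chain in
    \<open>C\<close>, and associativity descends.\<close>
  obtain f3 where f3: "f3 \<in> carrier B" "Src C f3 = Tgt C f2" and eq3: "c3 = mor_class f3"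
    using mor_class_Src[OF c3(1), of "Tgt C f2"] c3(2) eq f Tgt_Q Tgt_closed by metis
  have "Comp C f3 (Comp C f2 f1) = Comp C (Comp C f3 f2) f1"
    using category f f3 Mor_eq by (simp add: category_def)
  then show "Comp Q c3 (Comp Q c2 c1) = Comp Q (Comp Q c3 c2) c1"
    using f f3 by (simp add: eq eq3 Comp_Q Comp_C)
next
  fix x assume "x \<in> Obj Q"
  then obtain a where a: "a \<in> carrier A" "x = obj_class a" by (auto simp: Obj_Q)
  then obtain e where "is_identity C a e"
    using category Obj_eq by (auto simp: category_def)
  then show "\<exists>e. is_identity Q x e" using is_identity_Q a by blast
qed

lemma is_functor_Q: "is_functor C Q obj_class mor_class"
  unfolding is_functor_def
  by (simp add: category category_Q Src_Q Tgt_Q Comp_Q is_identity_Q Obj_eq Mor_eq Obj_Q Mor_Q)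

text \<open>The condition on \<open>c1\<close> and \<open>c2\<close> is only an equality of object
  cosets; \<open>composable_pair\<close> turns it into composability of representatives, after which
  \<open>induced_comp_iff\<close> gives existence and uniqueness together.\<close>

theorem quotient_category:
  "(\<forall>c\<in>lcosets\<^bsub>B\<^esub> L. \<exists>!d. induced_src C A K c d)
    \<and> (\<forall>c\<in>lcosets\<^bsub>B\<^esub> L. \<exists>!d. induced_tgt C A K c d)
    \<and> (\<forall>c1\<in>lcosets\<^bsub>B\<^esub> L. \<forall>c2\<in>lcosets\<^bsub>B\<^esub> L. Src Q c2 = Tgt Q c1 \<longrightarrow>
          (\<exists>!c. induced_comp C B L c2 c1 c))
    \<and> category Q
    \<and> is_functor C Q obj_class mor_class"
proof -
  have lcosets_eq: "lcosets\<^bsub>B\<^esub> L = Mor Q" by (simp add: quotient_cat_def)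
  have "\<exists>!c. induced_comp C B L c2 c1 c"
    if "c1 \<in> Mor Q" "c2 \<in> Mor Q" "Src Q c2 = Tgt Q c1" for c1 c2
    by (rule composable_pair[OF that]) (simp add: induced_comp_iff)
  moreover have "\<exists>!d. induced_src C A K c d" "\<exists>!d. induced_tgt C A K c d" if "c \<in> Mor Q" for c
    using that induced_src_iff induced_tgt_iff by (auto simp: Mor_Q)
  ultimately show ?thesis
    unfolding lcosets_eq by (simp add: category_Q is_functor_Q)
qed

end

section \<open>A crossed module with a normal subgroup \<open>N\<close> of \<open>H\<close>\<close>

locale crossed_module_normal =
  G: group G + H: group H + N: normal N H
  for G :: "('g, 'x) monoid_scheme" and H :: "('h, 'y) monoid_scheme"
    and \<alpha> :: "'g \<Rightarrow> 'h \<Rightarrow> 'h" and \<tau> :: "'h \<Rightarrow> 'g" and N :: "'h set" +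
  assumes crossed: "crossed_module G H \<alpha> \<tau>"
begin

abbreviation S :: "('h \<times> 'g) monoid" where "S \<equiv> semidirect H G \<alpha>"
abbreviation CG :: "('g, 'h \<times> 'g) cat" where "CG \<equiv> cat_group G H \<alpha> \<tau>"

sublocale \<tau>: group_hom H G \<tau>
  using crossed by unfold_locales (simp add: crossed_module_def)

lemma \<alpha>_auto: "g \<in> carrier G \<Longrightarrow> \<alpha> g \<in> auto H"
  using crossed by (auto simp: crossed_module_def AutoGroup_def dest: hom_in_carrier)

lemma \<alpha>_group_hom: "g \<in> carrier G \<Longrightarrow> group_hom H H (\<alpha> g)"
  using \<alpha>_auto by unfold_locales (simp add: auto_def)

lemma \<alpha>_closed [simp]: "\<lbrakk>g \<in> carrier G; h \<in> carrier H\<rbrakk> \<Longrightarrow> \<alpha> g h \<in> carrier H"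
  by (rule group_hom.hom_closed[OF \<alpha>_group_hom])

lemma \<alpha>_mult: "\<lbrakk>g \<in> carrier G; h \<in> carrier H; h' \<in> carrier H\<rbrakk>
    \<Longrightarrow> \<alpha> g (h \<otimes>\<^bsub>H\<^esub> h') = \<alpha> g h \<otimes>\<^bsub>H\<^esub> \<alpha> g h'"
  by (rule group_hom.hom_mult[OF \<alpha>_group_hom])

lemma \<alpha>_one [simp]: "g \<in> carrier G \<Longrightarrow> \<alpha> g \<one>\<^bsub>H\<^esub> = \<one>\<^bsub>H\<^esub>"
  by (rule group_hom.hom_one[OF \<alpha>_group_hom])

text \<open>The product of \<open>AutoGroup H\<close> is \<open>compose\<close> on the carrier of
  \<open>H\<close>, so it is plain composition at points of that carrier.\<close>

lemma \<alpha>_comp: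
  assumes "g \<in> carrier G" "g' \<in> carrier G" "h \<in> carrier H"
  shows "\<alpha> (g \<otimes>\<^bsub>G\<^esub> g') h = \<alpha> g (\<alpha> g' h)"
proof -
  have "\<alpha> (g \<otimes>\<^bsub>G\<^esub> g') = \<alpha> g \<otimes>\<^bsub>AutoGroup H\<^esub> \<alpha> g'"
    using crossed assms by (simp add: crossed_module_def hom_mult)
  then show ?thesis
    using \<alpha>_auto assms by (simp add: AutoGroup_def BijGroup_def auto_def compose_def)
qed

lemma \<alpha>_id [simp]:
  assumes "h \<in> carrier H" shows "\<alpha> \<one>\<^bsub>G\<^esub> h = h"
proof -
  have "\<alpha> \<one>\<^bsub>G\<^esub> = \<one>\<^bsub>AutoGroup H\<^esub>"
    using crossed hom_one[OF _ G.group_axioms H.AutoGroup] by (auto simp: crossed_module_def)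
  then show ?thesis using assms by (simp add: AutoGroup_def BijGroup_def)
qed

lemma \<tau>_\<alpha>: "\<lbrakk>g \<in> carrier G; h \<in> carrier H\<rbrakk>
    \<Longrightarrow> \<tau> (\<alpha> g h) = g \<otimes>\<^bsub>G\<^esub> \<tau> h \<otimes>\<^bsub>G\<^esub> inv\<^bsub>G\<^esub> g"
  using crossed by (simp add: crossed_module_def)

lemma peiffer: "\<lbrakk>h \<in> carrier H; h' \<in> carrier H\<rbrakk>
    \<Longrightarrow> \<alpha> (\<tau> h) h' = h \<otimes>\<^bsub>H\<^esub> h' \<otimes>\<^bsub>H\<^esub> inv\<^bsub>H\<^esub> h"
  using crossed by (simp add: crossed_module_def)

text \<open>Equivariance of \<tau> as a commutation rule free of inverses, used to compute targets
  on a coset.\<close>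

lemma \<tau>_\<alpha>_mult:
  assumes "g \<in> carrier G" "h \<in> carrier H"
  shows "\<tau> (\<alpha> g h) \<otimes>\<^bsub>G\<^esub> g = g \<otimes>\<^bsub>G\<^esub> \<tau> h"
  using assms by (simp add: \<tau>_\<alpha> G.m_assoc)

text \<open>The Peiffer identity as a commutation rule, used to move a factor past \<open>h\<close>
  in a composite.\<close>

lemma peiffer_mult:
  assumes "h \<in> carrier H" "h' \<in> carrier H"
  shows "\<alpha> (\<tau> h) h' \<otimes>\<^bsub>H\<^esub> h = h \<otimes>\<^bsub>H\<^esub> h'"
  using assms by (simp add: peiffer H.m_assoc)

section \<open>The semidirect product as a group\<close>

lemma carrier_S: "carrier S = carrier H \<times> carrier G"
  and mult_S: "(h2, g2) \<otimes>\<^bsub>S\<^esub> (h1, g1) = (h2 \<otimes>\<^bsub>H\<^esub> \<alpha> g2 h1, g2 \<otimes>\<^bsub>G\<^esub> g1)"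
  and one_S: "\<one>\<^bsub>S\<^esub> = (\<one>\<^bsub>H\<^esub>, \<one>\<^bsub>G\<^esub>)"
  by (simp_all add: semidirect_def)

text \<open>The first component collapses because \<alpha> of the inverse of \<open>g\<close> is
  multiplicative. A left inverse is enough both for \<open>groupI\<close> and for identifying
  \<open>inv\<close> in \<open>S\<close>.\<close>

lemma inverse_S:
  assumes "h \<in> carrier H" "g \<in> carrier G"
  shows "(\<alpha> (inv\<^bsub>G\<^esub> g) (inv\<^bsub>H\<^esub> h), inv\<^bsub>G\<^esub> g) \<otimes>\<^bsub>S\<^esub> (h, g) = \<one>\<^bsub>S\<^esub>"
  using assms by (simp add: mult_S one_S \<alpha>_mult[symmetric])

lemma group_S: "group S"
proof (rule groupI)
  fix x assume "x \<in> carrier S"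
  then show "\<exists>y\<in>carrier S. y \<otimes>\<^bsub>S\<^esub> x = \<one>\<^bsub>S\<^esub>"
    using inverse_S by (fastforce simp: carrier_S)
qed (auto simp: carrier_S mult_S one_S \<alpha>_mult \<alpha>_comp H.m_assoc G.m_assoc)

sublocale S: group S by (rule group_S)

lemma inv_S: "\<lbrakk>h \<in> carrier H; g \<in> carrier G\<rbrakk>
    \<Longrightarrow> inv\<^bsub>S\<^esub> (h, g) = (\<alpha> (inv\<^bsub>G\<^esub> g) (inv\<^bsub>H\<^esub> h), inv\<^bsub>G\<^esub> g)"
  by (rule S.inv_equality[OF inverse_S]) (simp_all add: carrier_S)

section \<open>The subgroup N \<times> \<tau>(N) and its cosets\<close>

text \<open>By the Peiffer identity \<open>\<alpha> (\<tau> h)\<close> is conjugation by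
  \<open>h\<close>, and \<open>N\<close> is normal. This closes N \<times> \<tau>(N) under the
  twisted product and under inverses.\<close>

lemma \<alpha>_\<tau>_N: "\<lbrakk>h \<in> carrier H; n \<in> N\<rbrakk> \<Longrightarrow> \<alpha> (\<tau> h) n \<in> N"
  by (simp add: peiffer N.mem_carrier N.inv_op_closed2)

lemma subgroup_\<tau>_N: "subgroup (\<tau> ` N) G"
  by (rule \<tau>.subgroup_img_is_subgroup[OF N.subgroup_axioms])

lemma subgroup_L: "subgroup (N \<times> \<tau> ` N) S"
proof (rule S.subgroupI)
  show "N \<times> \<tau> ` N \<subseteq> carrier S"
    unfolding carrier_S by (intro Sigma_mono N.subset subgroup.subset[OF subgroup_\<tau>_N])
  show "N \<times> \<tau> ` N \<noteq> {}" using N.one_closed by blast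
next
  fix x assume "x \<in> N \<times> \<tau> ` N"
  then obtain n m where x: "x = (n, \<tau> m)" "n \<in> N" "m \<in> N" by blast
  \<comment> \<open>Writing the inverse of \<open>\<tau> m\<close> as \<tau> of the inverse of
    \<open>m\<close> brings the first component into the shape of \<open>\<alpha>_\<tau>_N\<close>;
    \<open>hom_inv\<close> is switched off below to keep that shape.\<close>
  then have "inv\<^bsub>S\<^esub> x = (\<alpha> (\<tau> (inv\<^bsub>H\<^esub> m)) (inv\<^bsub>H\<^esub> n), \<tau> (inv\<^bsub>H\<^esub> m))"
    by (simp add: inv_S N.mem_carrier)
  moreover have "\<alpha> (\<tau> (inv\<^bsub>H\<^esub> m)) (inv\<^bsub>H\<^esub> n) \<in> N" "inv\<^bsub>H\<^esub> m \<in> N"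
    using x by (auto intro!: \<alpha>_\<tau>_N N.m_inv_closed simp: N.mem_carrier simp del: \<tau>.hom_inv)
  ultimately show "inv\<^bsub>S\<^esub> x \<in> N \<times> \<tau> ` N" by (metis SigmaI imageI)
next
  fix x y assume "x \<in> N \<times> \<tau> ` N" "y \<in> N \<times> \<tau> ` N"
  then obtain n m n' m' where xy: "x = (n, \<tau> m)" "y = (n', \<tau> m')"
    "n \<in> N" "m \<in> N" "n' \<in> N" "m' \<in> N"
    by blast
  then have "x \<otimes>\<^bsub>S\<^esub> y = (n \<otimes>\<^bsub>H\<^esub> \<alpha> (\<tau> m) n', \<tau> (m \<otimes>\<^bsub>H\<^esub> m'))"
    by (simp add: mult_S N.mem_carrier)
  moreover have "n \<otimes>\<^bsub>H\<^esub> \<alpha> (\<tau> m) n' \<in> N" "m \<otimes>\<^bsub>H\<^esub> m' \<in> N"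
    using xy by (auto intro!: \<alpha>_\<tau>_N N.m_closed simp: N.mem_carrier)
  ultimately show "x \<otimes>\<^bsub>S\<^esub> y \<in> N \<times> \<tau> ` N" by (metis SigmaI imageI)
qed

lemma mem_coset_S:
  "f \<in> (h, g) <#\<^bsub>S\<^esub> (N \<times> \<tau> ` N) \<longleftrightarrow>
    (\<exists>n\<in>N. \<exists>m\<in>N. f = (h \<otimes>\<^bsub>H\<^esub> \<alpha> g n, g \<otimes>\<^bsub>G\<^esub> \<tau> m))"
  by (auto simp: l_coset_def mult_S)

lemma mem_coset_G: "g' \<in> g <#\<^bsub>G\<^esub> (\<tau> ` N) \<longleftrightarrow> (\<exists>m\<in>N. g' = g \<otimes>\<^bsub>G\<^esub> \<tau> m)"
  by (auto simp: l_coset_def)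

lemma coset_G_mult:
  assumes "g \<in> carrier G" "m \<in> N"
  shows "(g \<otimes>\<^bsub>G\<^esub> \<tau> m) <#\<^bsub>G\<^esub> (\<tau> ` N) = g <#\<^bsub>G\<^esub> (\<tau> ` N)"
  using G.l_repr_independence[OF _ assms(1) subgroup_\<tau>_N] assms mem_coset_G by blast

section \<open>The categorical group and its structure maps on cosets\<close>

lemma Src_CG: "Src CG (h, g) = g"
  and Tgt_CG: "Tgt CG (h, g) = \<tau> h \<otimes>\<^bsub>G\<^esub> g"
  and Comp_CG: "Comp CG (h2, g2) (h1, g1) = (h2 \<otimes>\<^bsub>H\<^esub> h1, g1)"
  and Obj_CG: "Obj CG = carrier G"
  and Mor_CG: "Mor CG = carrier S"
  by (simp_all add: cat_group_def)

lemmas CG_simps = Src_CG Tgt_CG Comp_CG Obj_CG Mor_CG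

lemma category_CG: "category CG"
proof -
  have "is_identity CG a (\<one>\<^bsub>H\<^esub>, a)" if "a \<in> carrier G" for a
    using that by (auto simp: is_identity_def CG_simps carrier_S)
  then show ?thesis
    unfolding category_def by (auto simp: CG_simps carrier_S H.m_assoc G.m_assoc)
qed

text \<open>Equivariance carries \<open>\<tau> (\<alpha> g n)\<close> to the right of
  \<open>g\<close>, where it becomes \<open>\<tau> n\<close>. The target thus changes by a right
  factor from \<tau>(N) and stays in its left coset.\<close>

lemma Tgt_coset:
  assumes "h \<in> carrier H" "g \<in> carrier G" "n \<in> N" "m \<in> N"
  shows "Tgt CG (h \<otimes>\<^bsub>H\<^esub> \<alpha> g n, g \<otimes>\<^bsub>G\<^esub> \<tau> m) = \<tau> h \<otimes>\<^bsub>G\<^esub> g \<otimes>\<^bsub>G\<^esub> \<tau> (n \<otimes>\<^bsub>H\<^esub> m)"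
proof -
  note [simp] = N.mem_carrier
  have "Tgt CG (h \<otimes>\<^bsub>H\<^esub> \<alpha> g n, g \<otimes>\<^bsub>G\<^esub> \<tau> m)
      = \<tau> h \<otimes>\<^bsub>G\<^esub> (\<tau> (\<alpha> g n) \<otimes>\<^bsub>G\<^esub> g) \<otimes>\<^bsub>G\<^esub> \<tau> m"
    using assms by (simp add: Tgt_CG G.m_assoc)
  also have "\<dots> = \<tau> h \<otimes>\<^bsub>G\<^esub> g \<otimes>\<^bsub>G\<^esub> \<tau> (n \<otimes>\<^bsub>H\<^esub> m)"
    using assms by (simp add: \<tau>_\<alpha>_mult G.m_assoc)
  finally show ?thesis .
qed

text \<open>The action of the product splits into \<open>\<alpha> (\<tau> h1)\<close> after
  \<open>\<alpha> g\<close>; the Peiffer identity moves \<open>\<alpha> g n2\<close> past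
  \<open>h1\<close>, where it merges with \<open>\<alpha> g n1\<close>.\<close>

lemma Comp_coset:
  assumes "h1 \<in> carrier H" "g \<in> carrier G" "h2 \<in> carrier H" "n1 \<in> N" "n2 \<in> N"
  shows "h2 \<otimes>\<^bsub>H\<^esub> \<alpha> (\<tau> h1 \<otimes>\<^bsub>G\<^esub> g) n2 \<otimes>\<^bsub>H\<^esub> (h1 \<otimes>\<^bsub>H\<^esub> \<alpha> g n1)
    = h2 \<otimes>\<^bsub>H\<^esub> h1 \<otimes>\<^bsub>H\<^esub> \<alpha> g (n2 \<otimes>\<^bsub>H\<^esub> n1)"
proof -
  note [simp] = N.mem_carrier
  have "h2 \<otimes>\<^bsub>H\<^esub> \<alpha> (\<tau> h1 \<otimes>\<^bsub>G\<^esub> g) n2 \<otimes>\<^bsub>H\<^esub> (h1 \<otimes>\<^bsub>H\<^esub> \<alpha> g n1)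
      = h2 \<otimes>\<^bsub>H\<^esub> (\<alpha> (\<tau> h1) (\<alpha> g n2) \<otimes>\<^bsub>H\<^esub> h1) \<otimes>\<^bsub>H\<^esub> \<alpha> g n1"
    using assms by (simp add: \<alpha>_comp H.m_assoc)
  also have "\<dots> = h2 \<otimes>\<^bsub>H\<^esub> h1 \<otimes>\<^bsub>H\<^esub> \<alpha> g (n2 \<otimes>\<^bsub>H\<^esub> n1)"
    using assms by (simp add: peiffer_mult \<alpha>_mult H.m_assoc)
  finally show ?thesis .
qed

sublocale coset_category CG G "\<tau> ` N" S "N \<times> \<tau> ` N"
proof (intro coset_category.intro coset_category_axioms.intro G.group_axioms S.group_axioms
    subgroup_\<tau>_N subgroup_L category_CG Obj_CG Mor_CG)
  fix f f' assume "f \<in> carrier S" "f' \<in> f <#\<^bsub>S\<^esub> (N \<times> \<tau> ` N)"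
  then obtain h g n m where f: "f = (h, g)" "h \<in> carrier H" "g \<in> carrier G" "n \<in> N" "m \<in> N"
    and f': "f' = (h \<otimes>\<^bsub>H\<^esub> \<alpha> g n, g \<otimes>\<^bsub>G\<^esub> \<tau> m)"
    by (auto simp: carrier_S mem_coset_S)
  show "Src CG f' <#\<^bsub>G\<^esub> (\<tau> ` N) = Src CG f <#\<^bsub>G\<^esub> (\<tau> ` N)"
    using f f' by (simp add: Src_CG coset_G_mult)
  \<comment> \<open>Keeping \<tau> of the product of \<open>n\<close> and \<open>m\<close> as one
    factor (\<open>hom_mult\<close> removed) lets \<open>coset_G_mult\<close> absorb it.\<close>
  show "Tgt CG f' <#\<^bsub>G\<^esub> (\<tau> ` N) = Tgt CG f <#\<^bsub>G\<^esub> (\<tau> ` N)"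
    unfolding f' Tgt_coset[OF f(2-5)] using f by (simp add: Tgt_CG coset_G_mult del: \<tau>.hom_mult)
next
  fix f1 f2 f1' f2'
  assume "f1 \<in> carrier S" "f2 \<in> carrier S" "Src CG f2 = Tgt CG f1"
    "f1' \<in> f1 <#\<^bsub>S\<^esub> (N \<times> \<tau> ` N)" "f2' \<in> f2 <#\<^bsub>S\<^esub> (N \<times> \<tau> ` N)"
  \<comment> \<open>Composability forces the second component of \<open>f2\<close> to be the target
    of \<open>f1\<close>, so \<open>n2\<close> is twisted by that target.\<close>
  then obtain h1 g h2 n1 m1 n2 m2 where
    f: "f1 = (h1, g)" "f2 = (h2, \<tau> h1 \<otimes>\<^bsub>G\<^esub> g)" "h1 \<in> carrier H" "g \<in> carrier G" "h2 \<in> carrier H"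
    and n: "n1 \<in> N" "m1 \<in> N" "n2 \<in> N" "m2 \<in> N"
    and f1': "f1' = (h1 \<otimes>\<^bsub>H\<^esub> \<alpha> g n1, g \<otimes>\<^bsub>G\<^esub> \<tau> m1)"
    and f2': "f2' = (h2 \<otimes>\<^bsub>H\<^esub> \<alpha> (\<tau> h1 \<otimes>\<^bsub>G\<^esub> g) n2, \<tau> h1 \<otimes>\<^bsub>G\<^esub> g \<otimes>\<^bsub>G\<^esub> \<tau> m2)"
    by (auto simp: carrier_S mem_coset_S CG_simps)
  \<comment> \<open>The composite inherits its source from \<open>f1'\<close>, so its membership in
    the coset is witnessed by the product of \<open>n2\<close> and \<open>n1\<close> together with
    \<open>m1\<close>.\<close>
  have "Comp CG f2' f1' = (h2 \<otimes>\<^bsub>H\<^esub> h1 \<otimes>\<^bsub>H\<^esub> \<alpha> g (n2 \<otimes>\<^bsub>H\<^esub> n1), g \<otimes>\<^bsub>G\<^esub> \<tau> m1)"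
    using Comp_coset f n by (simp add: f1' f2' Comp_CG)
  then show "Comp CG f2' f1' \<in> Comp CG f2 f1 <#\<^bsub>S\<^esub> (N \<times> \<tau> ` N)"
    using n N.m_closed by (auto simp: f Comp_CG mem_coset_S)
next
  fix f b assume "f \<in> carrier S"
  then obtain h g where f: "f = (h, g)" "h \<in> carrier H" "g \<in> carrier G"
    by (auto simp: carrier_S)
  \<comment> \<open>Right multiplication by the unit of \<open>H\<close> paired with
    \<open>\<tau> m\<close> leaves \<open>h\<close> fixed and multiplies both source and target by
    \<open>\<tau> m\<close> on the right, so one family of representatives gives both lifts.\<close>
  have lift: "(h, g \<otimes>\<^bsub>G\<^esub> \<tau> m) \<in> f <#\<^bsub>S\<^esub> (N \<times> \<tau> ` N)" if "m \<in> N" for m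
    unfolding f(1) mem_coset_S using f that by (intro bexI[of _ "\<one>\<^bsub>H\<^esub>"] bexI[of _ m]) auto
  show "\<exists>f'\<in>f <#\<^bsub>S\<^esub> (N \<times> \<tau> ` N). Src CG f' = b" if "b \<in> Src CG f <#\<^bsub>G\<^esub> (\<tau> ` N)"
    using that lift f by (force simp: mem_coset_G Src_CG)
  show "\<exists>f'\<in>f <#\<^bsub>S\<^esub> (N \<times> \<tau> ` N). Tgt CG f' = b" if "b \<in> Tgt CG f <#\<^bsub>G\<^esub> (\<tau> ` N)"
  proof -
    obtain m where "m \<in> N" "b = \<tau> h \<otimes>\<^bsub>G\<^esub> g \<otimes>\<^bsub>G\<^esub> \<tau> m"
      using \<open>b \<in> Tgt CG f <#\<^bsub>G\<^esub> (\<tau> ` N)\<close> f by (auto simp: mem_coset_G Tgt_CG)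
    then show ?thesis
      using lift f by (intro bexI[OF _ lift]) (auto simp: Tgt_CG G.m_assoc N.mem_carrier)
  qed
qed

end

section \<open>The quotient by the image of a second crossed module\<close>

text \<open>By equivariance the conjugate of \<open>\<tau>' j\<close> by \<open>h\<close> is the
  image of \<open>\<alpha>' h j\<close>, and \<open>\<alpha>' h\<close> maps the carrier of
  \<open>J\<close> to itself.\<close>

lemma crossed_module_image_normal:
  assumes "crossed_module H J \<alpha>' \<tau>'"
  shows "\<tau>' ` carrier J \<lhd> H"
proof -
  have *: "group H" "group J" "\<tau>' \<in> hom J H" "\<alpha>' \<in> hom H (AutoGroup J)"
    "\<And>h j. \<lbrakk>h \<in> carrier H; j \<in> carrier J\<rbrakk>
      \<Longrightarrow> \<tau>' (\<alpha>' h j) = h \<otimes>\<^bsub>H\<^esub> \<tau>' j \<otimes>\<^bsub>H\<^esub> inv\<^bsub>H\<^esub> h"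
    using assms by (auto simp: crossed_module_def)
  interpret \<tau>': group_hom J H \<tau>'
    using * by (simp add: group_hom_def group_hom_axioms_def)
  show ?thesis
  proof (rule group.normal_invI[OF *(1) \<tau>'.img_is_subgroup])
    fix h x assume h: "h \<in> carrier H" and "x \<in> \<tau>' ` carrier J"
    then obtain j where j: "j \<in> carrier J" "x = \<tau>' j" by auto
    have "\<alpha>' h \<in> hom J J"
      using hom_in_carrier[OF *(4) h] by (simp add: AutoGroup_def auto_def)
    then have "\<alpha>' h j \<in> carrier J" using j by (simp add: hom_in_carrier)
    then show "h \<otimes>\<^bsub>H\<^esub> x \<otimes>\<^bsub>H\<^esub> inv\<^bsub>H\<^esub> h \<in> \<tau>' ` carrier J"
      using *(5)[OF h j(1)] j(2) by (metis imageI)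
  qed
qed

theorem proposition3p4:
  fixes G :: "'g lie_str" and H :: "'h lie_str" and J :: "'j lie_str"
    and \<alpha> :: "'g \<Rightarrow> 'h \<Rightarrow> 'h" and \<tau> :: "'h \<Rightarrow> 'g"
    and \<alpha>' :: "'h \<Rightarrow> 'j \<Rightarrow> 'j" and \<tau>' :: "'j \<Rightarrow> 'h"
  defines "HG \<equiv> semidirect H G \<alpha>"
    and "K \<equiv> J_obj J \<tau> \<tau>'"
    and "J\<^sub>H \<equiv> J_mor J \<tau> \<tau>'"
    and "CG \<equiv> cat_group G H \<alpha> \<tau>"
  defines "CQ \<equiv> quotient_cat CG G K HG J\<^sub>H"
  assumes "lie_crossed_module G H \<alpha> \<tau>"
    and "lie_crossed_module H J \<alpha>' \<tau>'"
    and "closedin (mtop (mfd H)) (\<tau>' ` carrier J)"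
    and "closedin (mtop (mfd G)) K"
  shows "(\<forall>c\<in>lcosets\<^bsub>HG\<^esub> J\<^sub>H. \<exists>!d. induced_src CG G K c d)
    \<and> (\<forall>c\<in>lcosets\<^bsub>HG\<^esub> J\<^sub>H. \<exists>!d. induced_tgt CG G K c d)
    \<and> (\<forall>c1\<in>lcosets\<^bsub>HG\<^esub> J\<^sub>H. \<forall>c2\<in>lcosets\<^bsub>HG\<^esub> J\<^sub>H. Src CQ c2 = Tgt CQ c1 \<longrightarrow>
          (\<exists>!c. induced_comp CG HG J\<^sub>H c2 c1 c))
    \<and> category CQ
    \<and> is_functor CG CQ (\<lambda>g. g <#\<^bsub>G\<^esub> K) (\<lambda>f. f <#\<^bsub>HG\<^esub> J\<^sub>H)"
proof -
  have crossed: "crossed_module G H \<alpha> \<tau>" and crossed': "crossed_module H J \<alpha>' \<tau>'"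
    using assms(6,7) by (simp_all add: lie_crossed_module_def)
  interpret crossed_module_normal G H \<alpha> \<tau> "\<tau>' ` carrier J"
    using crossed crossed_module_image_normal[OF crossed']
    by (intro crossed_module_normal.intro crossed_module_normal_axioms.intro)
      (simp_all add: crossed_module_def)
  \<comment> \<open>The two parameters in \<open>J_mor\<close> vary independently, so
    \<open>J\<^sub>H\<close> is the full product N \<times> \<tau>(N) for N = \<tau>'(J).\<close>
  have subgroups: "K = \<tau> ` \<tau>' ` carrier J" "J\<^sub>H = \<tau>' ` carrier J \<times> \<tau> ` \<tau>' ` carrier J"
    by (auto simp: assms(2,3) J_obj_def J_mor_def)
  show ?thesis
    unfolding subgroups assms(1,4,5) by (rule quotient_category)
qed

end
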